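(* Let $A, B$ be integers with $1 \leq B < A$. Let $\mathcal{P}$ be the set of Dyck paths whose down-run lengths avoid $\{Ar + B \mid r \geq 0\}$. Then $\mathcal{P}$ has the unambiguous grammar $$\mathcal{P} = \{\epsilon\} \cup \bigcup_{\substack{1 \leq k < A \\ k \neq B}} (U\mathcal{P})^{k-1} U D^k \mathcal{P} \ \cup\ (U\mathcal{P})^A D^A \mathcal{P},$$ where $\epsilon$ is the empty path, and therefore $$P(z) = 1 + \sum_{\substack{1 \leq k < A \\ k \neq B}} z^k P(z)^k + z^A P(z)^{A+1},$$ where $P(z)$ is the weight-enumerator of $\mathcal{P}$.
   Context: A Dyck path is a finite (possibly empty) word in the letters $U$ (standing for $+1$) and $D$ (standing for $-1$) whose partial sums are all nonnegative and whose total sum is $0$. A Dyck path of length $2n$ is said to have semilength $n$. A down-run of length $\ell$ is a block of $\ell$ consecutive $D$'s that is neither preceded nor followed by a $D$ (a maximal block of $D$'s). The down-run lengths of a path avoid a set $S$ if the path has no down-run whose length lies in $S$. In the grammar, sets of words over $\{U,D\}$ are combined by concatenation: for languages $L, L'$, $LL'$ is the set of words $ww'$ with $w\in L$, $w'\in L'$; $L^k$ is the $k$-fold concatenation, $L^0=\{\epsilon\}$; $U$ and $D$ denote the one-letter languages. The grammar being unambiguous means that each word of $\mathcal{P}$ belongs to exactly one of the cases of the union and, within that case, has exactly one factorization of the displayed form. The weight-enumerator of $\mathcal{P}$ is the formal power series $P(z) = \sum_{n \geq 0} p_n z^n$, where $p_n$ is the number of paths of semilength $n$ in $\mathcal{P}$.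 *)

theory Defs
  imports "HOL-Computational_Algebra.Formal_Power_Series"
begin

datatype step = U | D

fun step_val :: "step \<Rightarrow> int" where
  "step_val U = 1"
| "step_val D = - 1"

definition height :: "step list \<Rightarrow> int" where
  "height w = sum_list (map step_val w)"

definition dyck_path :: "step list \<Rightarrow> bool" where
  "dyck_path w \<longleftrightarrow> (\<forall>i\<le>length w. height (take i w) \<ge> 0) \<and> height w = 0"

definition has_down_run :: "step list \<Rightarrow> nat \<Rightarrow> bool" where
  "has_down_run w l \<longleftrightarrow> l \<ge> 1 \<and>
     (\<exists>xs ys. w = xs @ replicate l D @ ys \<and>
        (xs = [] \<or> last xs \<noteq> D) \<and> (ys = [] \<or> hd ys \<noteq> D))"

definition dyck_down_run_avoiding :: "nat set \<Rightarrow> step list set" where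
  "dyck_down_run_avoiding S = {w. dyck_path w \<and> (\<forall>l\<in>S. \<not> has_down_run w l)}"

text \<open>The coefficient of \<open>z\<^sup>n\<close> counts the paths of semilength \<open>n\<close>.\<close>

definition weight_enumerator :: "step list set \<Rightarrow> int fps" where
  "weight_enumerator L = Abs_fps (\<lambda>n. int (card {w \<in> L. length w = 2 * n}))"

definition conc :: "'a list set \<Rightarrow> 'a list set \<Rightarrow> 'a list set" (infixr "@@" 75) where
  "L @@ L' = {w @ w' | w w'. w \<in> L \<and> w' \<in> L'}"

primrec lang_pow :: "'a list set \<Rightarrow> nat \<Rightarrow> 'a list set" (infixr "^^^" 80) where
  "L ^^^ 0 = {[]}"
| "L ^^^ Suc n = L @@ (L ^^^ n)"

definition factorizations :: "'a list set list \<Rightarrow> 'a list \<Rightarrow> 'a list list set" where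
  "factorizations Ls w = {ws. list_all2 (\<in>) ws Ls \<and> concat ws = w}"

definition conc_list :: "'a list set list \<Rightarrow> 'a list set" where
  "conc_list Ls = {w. factorizations Ls w \<noteq> {}}"

text \<open>
  The union over \<open>i \<in> I\<close> of the concatenations of the factor lists \<open>F i\<close>
  describes the language \<open>L\<close> unambiguously. Cases are told apart by their index,
  so overlapping (or even equal) alternatives count as ambiguous.
\<close>

definition unambiguous_grammar ::
  "'a list set \<Rightarrow> 'i set \<Rightarrow> ('i \<Rightarrow> 'a list set list) \<Rightarrow> bool" where
  "unambiguous_grammar L I F \<longleftrightarrow>
     L = (\<Union>i\<in>I. conc_list (F i)) \<and>
     (\<forall>w\<in>L. (\<exists>!i. i \<in> I \<and> w \<in> conc_list (F i)) \<and>
            (\<forall>i\<in>I. w \<in> conc_list (F i) \<longrightarrow> (\<exists>!ws. ws \<in> factorizations (F i) w)))"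

datatype grammar_case = Empty_Case | Short_Case nat | Long_Case

definition grammar_cases :: "nat \<Rightarrow> nat \<Rightarrow> grammar_case set" where
  "grammar_cases A B = {Empty_Case} \<union> Short_Case ` {k. 1 \<le> k \<and> k < A \<and> k \<noteq> B} \<union> {Long_Case}"

text \<open>
  The factor lists of \<open>\<epsilon>\<close>, \<open>(U L)\<^bsup>k-1\<^esup> U D\<^bsup>k\<^esup> L\<close> and \<open>(U L)\<^bsup>A\<^esup> D\<^bsup>A\<^esup> L\<close>,
  with every letter and every copy of \<open>L\<close> as a separate factor.
\<close>

fun case_factors :: "step list set \<Rightarrow> nat \<Rightarrow> grammar_case \<Rightarrow> step list set list" where
  "case_factors L A Empty_Case = []"
| "case_factors L A (Short_Case k) =
     concat (replicate (k - 1) [{[U]}, L]) @ [{[U]}] @ replicate k {[D]} @ [L]"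
| "case_factors L A Long_Case =
     concat (replicate A [{[U]}, L]) @ replicate A {[D]} @ [L]"

lemma conc_list_Nil: "conc_list [] = {[]}"
  by (auto simp: conc_list_def factorizations_def)

lemma conc_list_Cons: "conc_list (L # Ls) = L @@ conc_list Ls"
  by (fastforce simp: conc_list_def factorizations_def conc_def list_all2_Cons2)

lemma conc_assoc: "(L @@ M) @@ N = L @@ M @@ N"
  unfolding conc_def by (auto; metis append.assoc)

lemma conc_Nil [simp]: "{[]} @@ L = L" "L @@ {[]} = L"
  by (auto simp: conc_def)

lemma conc_list_append: "conc_list (Ls @ Ms) = conc_list Ls @@ conc_list Ms"
  by (induction Ls) (simp_all add: conc_list_Nil conc_list_Cons conc_assoc)

lemma conc_list_replicate: "conc_list (replicate n L) = L ^^^ n"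
  by (induction n) (simp_all add: conc_list_Nil conc_list_Cons)

lemma conc_list_concat_replicate: "conc_list (concat (replicate n Ls)) = conc_list Ls ^^^ n"
  by (induction n) (simp_all add: conc_list_Nil conc_list_append)

lemma conc_list_case_factors:
  "conc_list (case_factors L A Empty_Case) = {[]}"
  "conc_list (case_factors L A (Short_Case k)) =
     (({[U]} @@ L) ^^^ (k - 1)) @@ {[U]} @@ ({[D]} ^^^ k) @@ L"
  "conc_list (case_factors L A Long_Case) =
     (({[U]} @@ L) ^^^ A) @@ ({[D]} ^^^ A) @@ L"
  by (simp_all add: conc_list_append conc_list_Nil conc_list_Cons conc_list_replicate
      conc_list_concat_replicate conc_assoc)

end

theory Submission
  imports Defs
begin

text \<open>
  A nonempty Dyck path is uniquely \<open>U a D b\<close> with \<open>a\<close>, \<open>b\<close> Dyck paths (first return to the axis),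
  and a nonempty Dyck path \<open>a\<close> is uniquely \<open>p U c D\<close> (last return).
  Let \<open>T j\<close> be the set of Dyck paths \<open>a\<close> such that \<open>a D\<^sup>j\<close> avoids the forbidden run lengths.
  Then the nonempty elements of \<open>\<P>\<close> form \<open>U (T 1) D \<P>\<close>, while \<open>T j\<close> consists of
  \<open>\<P> U (T (j+1)) D\<close> and, if \<open>j\<close> is allowed, the empty path. The forbidden set is periodic
  with period \<open>A\<close> and \<open>A\<close> itself is allowed, so \<open>T A = \<P>\<close>, and unfolding \<open>T 1\<close> until \<open>T A\<close> is
  reached yields the grammar. The functional equation follows by marking each \<open>U\<close> by \<open>z\<close>
  and each \<open>D\<close> by \<open>1\<close>, which turns unambiguous concatenation into multiplication.
\<close>

section \<open>Dyck paths\<close>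

lemma height_simps [simp]:
  "height [] = 0"
  "height (s # w) = step_val s + height w"
  "height (v @ w) = height v + height w"
  by (simp_all add: height_def)

text \<open>Quantifying over splittings instead of indices lets prefixes be matched directly against
  appended words.\<close>

lemma dyck_path_prefix:
  "dyck_path w \<longleftrightarrow> (\<forall>xs ys. w = xs @ ys \<longrightarrow> height xs \<ge> 0) \<and> height w = 0"
proof -
  have "(\<forall>i\<le>length w. height (take i w) \<ge> 0) \<longleftrightarrow> (\<forall>xs ys. w = xs @ ys \<longrightarrow> height xs \<ge> 0)"
    by (metis append_eq_conv_conj append_take_drop_id length_append le_add1)
  then show ?thesis by (simp add: dyck_path_def)
qed

lemma dyck_path_height: "dyck_path w \<Longrightarrow> height w = 0"
  by (simp add: dyck_path_def)

lemma dyck_path_prefix_nonneg: "dyck_path (xs @ ys) \<Longrightarrow> height xs \<ge> 0"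
  by (simp add: dyck_path_prefix)

lemma dyck_path_suffix_nonpos: "dyck_path (xs @ ys) \<Longrightarrow> height ys \<le> 0"
  using dyck_path_prefix_nonneg[of xs ys] dyck_path_height[of "xs @ ys"] by simp

lemma dyck_path_Nil [simp]: "dyck_path []"
  by (simp add: dyck_path_def)

lemma dyck_path_append: "dyck_path v \<Longrightarrow> dyck_path w \<Longrightarrow> dyck_path (v @ w)"
  unfolding dyck_path_prefix append_eq_append_conv2 by fastforce

lemma dyck_path_appendD: "dyck_path (v @ w) \<Longrightarrow> dyck_path v \<Longrightarrow> dyck_path w"
  unfolding dyck_path_prefix by (metis append.assoc height_simps(3) add_0)

lemma dyck_path_wrap:
  assumes "dyck_path a"
  shows "dyck_path (U # a @ [D])"
  unfolding dyck_path_prefix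
proof (intro conjI allI impI)
  fix xs ys assume eq: "U # a @ [D] = xs @ ys"
  show "height xs \<ge> 0"
  proof (cases "xs = [] \<or> ys = []")
    case True
    then show ?thesis using eq dyck_path_height[OF assms] by (metis append.right_neutral
        height_simps add.right_neutral step_val.simps add.left_neutral add.right_inverse order.refl)
  next
    case False
    then obtain xs' ys' where "xs = U # xs'" "ys = ys' @ [D]"
      using eq by (metis append_Cons append_eq_Cons_conv append_butlast_last_id last_ConsR
          last_append last_snoc snoc_eq_iff_butlast)
    with eq have "a = xs' @ ys'" by simp
    then show ?thesis using dyck_path_prefix_nonneg assms \<open>xs = U # xs'\<close> by simp
  qed
qed (use dyck_path_height[OF assms] in simp)

lemma dyck_path_first: "dyck_path a \<Longrightarrow> dyck_path b \<Longrightarrow> dyck_path (U # a @ D # b)"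
  using dyck_path_append[OF dyck_path_wrap] by simp

lemma dyck_path_last: "dyck_path p \<Longrightarrow> dyck_path c \<Longrightarrow> dyck_path (p @ U # c @ [D])"
  using dyck_path_append dyck_path_wrap by simp

section \<open>Existence and uniqueness of the first and last return\<close>

lemma negative_height_split:
  "height v < 0 \<Longrightarrow> \<exists>a b. v = a @ D # b \<and> dyck_path a"
proof (induction v rule: length_induct)
  case (1 v)
  show ?case
  proof (cases v)
    case Nil
    then show ?thesis using "1.prems" by simp
  next
    case (Cons s v')
    show ?thesis
    proof (cases s)
      case D
      then show ?thesis using Cons by (intro exI[of _ "[]"] exI[of _ v']) simp
    next
      case U
      \<comment> \<open>Dropping the \<open>U\<close> makes the height even smaller, so
        \<open>v'\<close> splits. The block \<open>U a D\<close> has height 0, so \<open>b\<close>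
        inherits the negative height of \<open>v\<close> and splits again.\<close>
      then obtain a b where ab: "v' = a @ D # b" "dyck_path a"
        using 1 Cons by fastforce
      then have "height b < 0" using "1.prems" Cons U dyck_path_height by fastforce
      then obtain a' b' where "b = a' @ D # b'" "dyck_path a'"
        using "1.IH"[rule_format, of b] Cons ab by auto
      then have "v = (U # a @ D # a') @ D # b'" "dyck_path (U # a @ D # a')"
        using Cons U ab dyck_path_first by simp_all
      then show ?thesis by blast
    qed
  qed
qed

lemma dyck_path_first_return:
  assumes "dyck_path w" "w \<noteq> []"
  obtains a b where "w = U # a @ D # b" "dyck_path a" "dyck_path b"
proof -
  obtain s v where w: "w = s # v" using assms(2) by (cases w) auto
  have s: "s = U" using dyck_path_prefix_nonneg[of "[s]" v] assms w by (cases s) auto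
  have "height v < 0" using dyck_path_height[OF assms(1)] w s by simp
  then obtain a b where ab: "v = a @ D # b" "dyck_path a" using negative_height_split by blast
  have "dyck_path ((U # a @ [D]) @ b)" using assms w s ab by simp
  then have "dyck_path b" using dyck_path_appendD dyck_path_wrap ab by blast
  then show ?thesis using that w s ab by simp
qed

text \<open>Obtained by iterating the first return: as long as \<open>b\<close> is nonempty, its
  last return is that of \<open>w\<close>, with \<open>U a D\<close> moved to the front of
  \<open>p\<close>.\<close>

lemma dyck_path_last_return:
  assumes "dyck_path w" "w \<noteq> []"
  obtains p c where "w = p @ U # c @ [D]" "dyck_path p" "dyck_path c"
proof -
  have "\<exists>p c. w = p @ U # c @ [D] \<and> dyck_path p \<and> dyck_path c"
    using assms
  proof (induction w rule: length_induct)
    case (1 w)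
    then obtain a b where ab: "w = U # a @ D # b" "dyck_path a" "dyck_path b"
      using dyck_path_first_return by metis
    show ?case
    proof (cases "b = []")
      case True
      then show ?thesis using ab by (intro exI[of _ "[]"] exI[of _ a]) simp
    next
      case False
      then obtain p c where "b = p @ U # c @ [D]" "dyck_path p" "dyck_path c"
        using "1.IH"[rule_format, of b] ab by auto
      then show ?thesis using ab dyck_path_first
        by (intro exI[of _ "U # a @ D # p"] exI[of _ c]) simp
    qed
  qed
  then show ?thesis using that by blast
qed

text \<open>If the two cuts differed, one of the Dyck paths would be \<open>x D z\<close> with
  \<open>x\<close> the other one, and its prefix \<open>x D\<close> would have height -1.\<close>

lemma first_return_unique:
  assumes "dyck_path a" "dyck_path a'" "a @ D # b = a' @ D # b'"
  shows "a = a' \<and> b = b'"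
proof -
  have *: False if "dyck_path x" "dyck_path (x @ D # z)" for x z
    using dyck_path_prefix_nonneg[of "x @ [D]" z] dyck_path_height[of x] that by simp
  obtain us where "a = a' @ us \<and> us @ D # b = D # b' \<or> a' = a @ us \<and> us @ D # b' = D # b"
    using assms(3) unfolding append_eq_append_conv2 by metis
  then show ?thesis using *[of a' "tl us"] *[of a "tl us"] assms by (cases us) auto
qed

text \<open>Mirror image of the first return: different cuts would give a Dyck path with suffix
  \<open>U x\<close> of height 1, but suffixes of Dyck paths never have positive height.\<close>

lemma last_return_unique:
  assumes "dyck_path c" "dyck_path c'" "p @ U # c = p' @ U # c'"
  shows "p = p' \<and> c = c'"
proof -
  have *: False if "dyck_path x" "dyck_path (z @ U # x)" for x z
    using dyck_path_suffix_nonpos[of z "U # x"] dyck_path_height[of x] that by simp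
  obtain us where "p = p' @ us \<and> us @ U # c = U # c' \<or> p' = p @ us \<and> us @ U # c' = U # c"
    using assms(3) unfolding append_eq_append_conv2 by metis
  then show ?thesis using *[of c "tl us"] *[of c' "tl us"] assms by (cases us) auto
qed

lemma height_count_list: "height w = 2 * int (count_list w U) - int (length w)"
proof (induction w)
  case (Cons s w)
  then show ?case by (cases s) simp_all
qed simp

lemma dyck_path_length: "dyck_path w \<Longrightarrow> length w = 2 * count_list w U"
  using dyck_path_height[of w] height_count_list[of w] by simp


section \<open>Avoided down-runs\<close>

definition avoids :: "nat set \<Rightarrow> step list \<Rightarrow> bool" where
  "avoids S w \<longleftrightarrow> (\<forall>l\<in>S. \<not> has_down_run w l)"

text \<open>A block of \<open>D\<close>'s cannot cross the \<open>U\<close>, and for maximality a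
  neighbouring \<open>U\<close> acts just like the end of the word.\<close>

lemma has_down_run_append_U:
  "has_down_run (x @ U # y) l \<longleftrightarrow> has_down_run x l \<or> has_down_run y l"
proof
  assume "has_down_run (x @ U # y) l"
  then obtain xs ys where l: "l \<ge> 1" and eq: "x @ U # y = xs @ replicate l D @ ys"
    and xs: "xs = [] \<or> last xs \<noteq> D" and ys: "ys = [] \<or> hd ys \<noteq> D"
    unfolding has_down_run_def by blast
  \<comment> \<open>The block starts either before the separating \<open>U\<close> or after
    it.\<close>
  consider us where "x = xs @ us" "us @ U # y = replicate l D @ ys"
    | us where "xs = x @ U # us" "y = us @ replicate l D @ ys"
    using eq l by (auto simp: append_eq_append_conv2 Cons_eq_append_conv)
  then show "has_down_run x l \<or> has_down_run y l"
  proof cases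
    case 1
    \<comment> \<open>A block starting before the \<open>U\<close> also ends before it, since it
      contains no \<open>U\<close>.\<close>
    have "\<exists>vs. us = replicate l D @ vs \<and> ys = vs @ U # y"
    proof -
      obtain vs where "us = replicate l D @ vs \<and> ys = vs @ U # y \<or>
          us @ vs = replicate l D \<and> U # y = vs @ ys"
        using 1(2) by (auto simp: append_eq_append_conv2)
      moreover have "U \<notin> set vs" if "us @ vs = replicate l D"
        using that by (metis Un_iff in_set_replicate set_append step.distinct(1))
      ultimately show ?thesis by (cases vs) auto
    qed
    then obtain vs where "us = replicate l D @ vs" "ys = vs @ U # y" by blast
    then have "has_down_run x l"
      unfolding has_down_run_def using 1 l xs ys
      by (intro conjI exI[of _ xs] exI[of _ vs]) (auto simp: hd_append split: if_splits)
    then show ?thesis ..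
  next
    case 2
    then have "has_down_run y l"
      unfolding has_down_run_def using l xs ys
      by (intro conjI exI[of _ us] exI[of _ ys]) (auto split: if_splits)
    then show ?thesis ..
  qed
next
  assume "has_down_run x l \<or> has_down_run y l"
  then show "has_down_run (x @ U # y) l"
  proof
    assume "has_down_run x l"
    then obtain xs ys where "l \<ge> 1" "x = xs @ replicate l D @ ys"
      "xs = [] \<or> last xs \<noteq> D" "ys = [] \<or> hd ys \<noteq> D"
      unfolding has_down_run_def by blast
    then show ?thesis unfolding has_down_run_def
      by (intro conjI exI[of _ xs] exI[of _ "ys @ U # y"]) (auto simp: hd_append)
  next
    assume "has_down_run y l"
    then obtain xs ys where "l \<ge> 1" "y = xs @ replicate l D @ ys"
      "xs = [] \<or> last xs \<noteq> D" "ys = [] \<or> hd ys \<noteq> D"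
      unfolding has_down_run_def by blast
    then show ?thesis unfolding has_down_run_def
      by (intro conjI exI[of _ "x @ U # xs"] exI[of _ ys]) auto
  qed
qed

lemma has_down_run_replicate: "has_down_run (replicate m D) l \<longleftrightarrow> l = m \<and> l \<ge> 1"
proof
  assume "has_down_run (replicate m D) l"
  then obtain xs ys where l: "l \<ge> 1" and eq: "replicate m D = xs @ replicate l D @ ys"
    and xs: "xs = [] \<or> last xs \<noteq> D" and ys: "ys = [] \<or> hd ys \<noteq> D"
    unfolding has_down_run_def by blast
  have "set (xs @ replicate l D @ ys) \<subseteq> {D}" by (subst eq[symmetric]) auto
  then have sub: "set xs \<subseteq> {D}" "set ys \<subseteq> {D}" by auto
  have "xs = []" using xs sub(1) last_in_set[of xs] by blast
  moreover have "ys = []" using ys sub(2) hd_in_set[of ys] by blast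
  ultimately show "l = m \<and> l \<ge> 1" using l arg_cong[OF eq, of length] by simp
next
  assume "l = m \<and> l \<ge> 1"
  then show "has_down_run (replicate m D) l"
    unfolding has_down_run_def by (intro conjI exI[of _ "[]"]) auto
qed

section \<open>Avoidance under concatenation\<close>

lemma avoids_append_U: "avoids S (x @ U # y) \<longleftrightarrow> avoids S x \<and> avoids S y"
  by (auto simp: avoids_def has_down_run_append_U)

lemma avoids_replicate: "avoids S (replicate m D) \<longleftrightarrow> m = 0 \<or> m \<notin> S"
  by (auto simp: avoids_def has_down_run_replicate)

lemma avoids_Nil [simp]: "avoids S []"
  using avoids_replicate[of S 0] by simp

lemma avoids_Cons_U [simp]: "avoids S (U # y) \<longleftrightarrow> avoids S y"
  using avoids_append_U[of S "[]" y] by simp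

text \<open>A nonempty Dyck path starts with \<open>U\<close>, so no runs merge at the
  junction.\<close>

lemma avoids_append_dyck:
  assumes "dyck_path b"
  shows "avoids S (x @ b) \<longleftrightarrow> avoids S x \<and> avoids S b"
proof (cases "b = []")
  case False
  then obtain b' where "b = U # b'" using assms dyck_path_first_return by metis
  then show ?thesis by (simp add: avoids_append_U)
qed simp

text \<open>Isolates the only run that appending \<open>D\<close>'s can change; \<open>m\<close> may
  be 0.\<close>

lemma trailing_down_run:
  obtains m where "w = replicate m D" | x m where "w = x @ U # replicate m D"
proof -
  have "(\<exists>m. w = replicate m D) \<or> (\<exists>x m. w = x @ U # replicate m D)"
  proof (induction w rule: rev_induct)
    case Nil
    then show ?case by (auto intro: exI[of _ "0::nat"])
  next
    case (snoc s w)
    show ?case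
    proof (cases s)
      case U
      then have "w @ [s] = w @ U # replicate 0 D" by simp
      then show ?thesis by blast
    next
      case D
      then have "\<And>m. replicate m D @ [s] = replicate (Suc m) D"
        by (simp add: replicate_append_same)
      then show ?thesis using snoc by (metis append.assoc append_Cons)
    qed
  qed
  then show ?thesis using that by blast
qed

text \<open>Only the trailing run changes, from \<open>m\<close> to \<open>m + A\<close>. For
  \<open>m\<close> positive, periodicity preserves membership in \<open>S\<close>; for
  \<open>m = 0\<close> a new run of the allowed length \<open>A\<close> appears.\<close>

lemma avoids_append_period:
  assumes "A \<notin> S" "\<And>m. m \<ge> 1 \<Longrightarrow> m + A \<in> S \<longleftrightarrow> m \<in> S" "A \<ge> 1"
  shows "avoids S (w @ replicate A D) \<longleftrightarrow> avoids S w"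
proof -
  have *: "avoids S (replicate m D @ replicate A D) \<longleftrightarrow> avoids S (replicate m D)" for m
    unfolding replicate_add[symmetric] avoids_replicate using assms(1,3) assms(2)[of m] by (cases "m = 0") auto
  show ?thesis
    by (cases w rule: trailing_down_run) (simp_all add: * avoids_append_U)
qed


section \<open>Unfolding the last return\<close>

text \<open>Records successive last-return decompositions with innermost path \<open>c\<close>.
  Written flat it is p1 U p2 U ... pn U c followed by n letters \<open>D\<close>, which is the shape
  occurring in the grammar.\<close>

fun nest :: "step list list \<Rightarrow> step list \<Rightarrow> step list" where
  "nest [] c = c"
| "nest (p # ps) c = p @ U # nest ps c @ [D]"

lemma dyck_path_nest:
  "\<forall>p\<in>set ps. dyck_path p \<Longrightarrow> dyck_path c \<Longrightarrow> dyck_path (nest ps c)"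
  by (induction ps) (simp_all add: dyck_path_last)

text \<open>Cancel the final \<open>D\<close> and apply uniqueness of the last return, layer by
  layer.\<close>

lemma nest_unique:
  assumes "nest ps c = nest qs d" "length ps = length qs"
    and "\<forall>p\<in>set ps. dyck_path p" "\<forall>q\<in>set qs. dyck_path q" "dyck_path c" "dyck_path d"
  shows "ps = qs \<and> c = d"
  using assms(2,1,3-)
proof (induction ps qs rule: list_induct2)
  case (Cons p ps q qs)
  have "p @ U # nest ps c = q @ U # nest qs d"
    using Cons.prems(1) by (metis append_Cons append_assoc butlast_snoc nest.simps(2))
  then have "p = q \<and> nest ps c = nest qs d"
    using Cons.prems by (intro last_return_unique dyck_path_nest) auto
  then show ?case using Cons by simp
qed simp

text \<open>Recovers the depth: once all layers of \<open>ps\<close> are peeled off, the left side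
  is empty, whereas any remaining layer on the right would contain a \<open>U\<close>.\<close>

lemma nest_Nil_unique:
  assumes "nest ps [] = nest qs d" "length ps \<le> length qs"
    and "\<forall>p\<in>set ps. dyck_path p" "\<forall>q\<in>set qs. dyck_path q" "dyck_path d"
  shows "length ps = length qs"
  using assms
proof (induction ps arbitrary: qs)
  case Nil
  then show ?case by (cases qs) auto
next
  case (Cons p ps)
  then obtain q qs' where qs: "qs = q # qs'" by (cases qs) auto
  have "p @ U # nest ps [] = q @ U # nest qs' d"
    using Cons.prems(1) qs by (metis append_Cons append_assoc butlast_snoc nest.simps(2))
  then have "p = q \<and> nest ps [] = nest qs' d"
    using Cons.prems qs by (intro last_return_unique dyck_path_nest) auto
  then show ?case using Cons qs by simp
qed

text \<open>The sets \<open>T j\<close> of the overview. The \<open>j\<close> letters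
  \<open>D\<close> stand for the closing steps of the enclosing decompositions, which lengthen the
  trailing run of \<open>a\<close>.\<close>

definition avoiding_before :: "nat set \<Rightarrow> nat \<Rightarrow> step list set" where
  "avoiding_before S j = {a. dyck_path a \<and> avoids S (a @ replicate j D)}"

lemma avoiding_before_0: "avoiding_before S 0 = dyck_down_run_avoiding S"
  by (simp add: avoiding_before_def dyck_down_run_avoiding_def avoids_def)

text \<open>For empty \<open>a\<close> the whole word is a single run of length \<open>j\<close>,
  which exists only for positive \<open>j\<close>. Otherwise \<open>U\<close> separates
  \<open>p\<close> from \<open>c\<close>, and the closing \<open>D\<close> joins the
  \<open>j\<close> letters that follow, so \<open>c\<close> faces a run of
  \<open>j + 1\<close>.\<close>

lemma avoiding_before_last_return:
  assumes "j \<ge> 1"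
  shows "a \<in> avoiding_before S j \<longleftrightarrow> (a = [] \<and> j \<notin> S) \<or>
    (\<exists>p\<in>dyck_down_run_avoiding S. \<exists>c\<in>avoiding_before S (Suc j). a = p @ U # c @ [D])"
proof (cases "a = []")
  case True
  then show ?thesis using assms by (simp add: avoiding_before_def avoids_replicate)
next
  case False
  have *: "avoids S ((p @ U # c @ [D]) @ replicate j D) \<longleftrightarrow>
      avoids S p \<and> avoids S (c @ replicate (Suc j) D)" for p c
    by (simp add: avoids_append_U)
  show ?thesis
  proof
    assume a: "a \<in> avoiding_before S j"
    then obtain p c where "a = p @ U # c @ [D]" "dyck_path p" "dyck_path c"
      using False dyck_path_last_return unfolding avoiding_before_def by blast
    moreover from this have "p \<in> avoiding_before S 0" "c \<in> avoiding_before S (Suc j)"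
      using a *[of p c] by (simp_all add: avoiding_before_def)
    ultimately show "(a = [] \<and> j \<notin> S) \<or>
      (\<exists>p\<in>dyck_down_run_avoiding S. \<exists>c\<in>avoiding_before S (Suc j). a = p @ U # c @ [D])"
      unfolding avoiding_before_0 by blast
  next
    assume "(a = [] \<and> j \<notin> S) \<or>
      (\<exists>p\<in>dyck_down_run_avoiding S. \<exists>c\<in>avoiding_before S (Suc j). a = p @ U # c @ [D])"
    then obtain p c where "p \<in> dyck_down_run_avoiding S" "c \<in> avoiding_before S (Suc j)"
      "a = p @ U # c @ [D]" using False by blast
    then show "a \<in> avoiding_before S j"
      using *[of p c] dyck_path_last unfolding avoiding_before_0[symmetric]
      by (simp add: avoiding_before_def)
  qed
qed

text \<open>Unfolds the last return at most \<open>n\<close> times. Either the empty path is met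
  early, leaving an innermost run of length \<open>j + length ps\<close> that must be allowed, or
  all \<open>n\<close> layers are peeled and \<open>c\<close> remains.\<close>

lemma avoiding_before_nest:
  assumes "j \<ge> 1"
  shows "a \<in> avoiding_before S j \<longleftrightarrow>
    (\<exists>ps. length ps < n \<and> set ps \<subseteq> dyck_down_run_avoiding S \<and> j + length ps \<notin> S \<and> a = nest ps []) \<or>
    (\<exists>ps c. length ps = n \<and> set ps \<subseteq> dyck_down_run_avoiding S \<and> c \<in> avoiding_before S (j + n) \<and>
       a = nest ps c)"
  using assms
proof (induction n arbitrary: j a)
  case 0
  then show ?case by simp
next
  case (Suc n)
  let ?L = "dyck_down_run_avoiding S" and ?T = "avoiding_before S"
  have step: "a \<in> ?T j \<longleftrightarrow> (a = [] \<and> j \<notin> S) \<or>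
    (\<exists>p\<in>?L. \<exists>c\<in>?T (Suc j). a = p @ U # c @ [D])"
    by (rule avoiding_before_last_return) (rule Suc.prems)
  have IH: "c \<in> ?T (Suc j) \<longleftrightarrow>
    (\<exists>ps. length ps < n \<and> set ps \<subseteq> ?L \<and> Suc j + length ps \<notin> S \<and> c = nest ps []) \<or>
    (\<exists>ps d. length ps = n \<and> set ps \<subseteq> ?L \<and> d \<in> ?T (Suc j + n) \<and> c = nest ps d)" for c
    by (rule Suc.IH) simp
  let ?short = "\<lambda>ps. length ps < Suc n \<and> set ps \<subseteq> ?L \<and> j + length ps \<notin> S \<and> a = nest ps []"
  let ?long = "\<lambda>ps d. length ps = Suc n \<and> set ps \<subseteq> ?L \<and> d \<in> ?T (j + Suc n) \<and> a = nest ps d"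
  show ?case
  proof
    assume "a \<in> ?T j"
    then consider "a = []" "j \<notin> S" | p c where "p \<in> ?L" "c \<in> ?T (Suc j)" "a = p @ U # c @ [D]"
      using step by blast
    then show "(\<exists>ps. ?short ps) \<or> (\<exists>ps d. ?long ps d)"
    proof cases
      case 1
      then have "?short []" by simp
      then show ?thesis by blast
    next
      case 2
      then consider ps where "length ps < n" "set ps \<subseteq> ?L" "Suc j + length ps \<notin> S" "c = nest ps []"
        | ps d where "length ps = n" "set ps \<subseteq> ?L" "d \<in> ?T (Suc j + n)" "c = nest ps d"
        using IH by blast
      then show ?thesis
      proof cases
        case (1 ps)
        then have "?short (p # ps)" using 2 by simp
        then show ?thesis by blast
      next
        case (2 ps d)
        then have "?long (p # ps) d" using \<open>p \<in> ?L\<close> \<open>a = p @ U # c @ [D]\<close> by simp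
        then show ?thesis by blast
      qed
    qed
  next
    assume "(\<exists>ps. ?short ps) \<or> (\<exists>ps d. ?long ps d)"
    \<comment> \<open>A long witness has \<open>Suc n\<close> entries, so it always has a first
      layer to split off.\<close>
    then consider "?short []" | p ps where "?short (p # ps)" | p ps d where "?long (p # ps) d"
      by (metis length_0_conv nat.distinct(1) list.exhaust)
    then show "a \<in> ?T j"
    proof cases
      case 1
      then show ?thesis using step by simp
    next
      case (2 p ps)
      then have "nest ps [] \<in> ?T (Suc j)" using IH by auto
      then show ?thesis using 2 step by auto
    next
      case (3 p ps d)
      then have "nest ps d \<in> ?T (Suc j)" using IH by auto
      then show ?thesis using 3 step by auto
    qed
  qed
qed

text \<open>The returning \<open>D\<close> extends the trailing run of \<open>a\<close>, hence index
  1. The run stops there because \<open>b\<close> is empty or starts with \<open>U\<close>.\<close>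

lemma avoiding_first_return:
  "w \<in> dyck_down_run_avoiding S \<longleftrightarrow> w = [] \<or>
     (\<exists>a\<in>avoiding_before S 1. \<exists>b\<in>dyck_down_run_avoiding S. w = U # a @ D # b)"
    (is "?l \<longleftrightarrow> ?r")
proof
  have *: "avoids S (U # a @ D # b) \<longleftrightarrow> avoids S (a @ [D]) \<and> avoids S b" if "dyck_path b" for a b
    using avoids_append_dyck[OF that, of S "a @ [D]"] by simp
  note defs = avoiding_before_0[symmetric] avoiding_before_def
  {
    assume w: ?l
    show ?r
    proof (cases "w = []")
      case False
      then obtain a b where "w = U # a @ D # b" "dyck_path a" "dyck_path b"
        using w dyck_path_first_return unfolding defs by blast
      moreover from this have "a \<in> avoiding_before S 1" "b \<in> dyck_down_run_avoiding S"
        using w *[of b a] by (simp_all add: defs)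
      ultimately show ?thesis by blast
    qed simp
  next
    assume ?r
    then consider "w = []" | a b where "w = U # a @ D # b" "a \<in> avoiding_before S 1"
        "b \<in> dyck_down_run_avoiding S" by blast
    then show ?l
    proof cases
      case (2 a b)
      then show ?thesis using *[of b a] dyck_path_first[of a b] by (simp add: defs)
    qed (simp add: defs)
  }
qed


section \<open>The grammar\<close>

definition up_blocks :: "step list list \<Rightarrow> step list list" where
  "up_blocks ps = concat (map (\<lambda>p. [[U], p]) ps)"

lemma up_blocks_simps [simp]:
  "up_blocks [] = []"
  "up_blocks (p # ps) = [U] # p # up_blocks ps"
  "up_blocks (ps @ qs) = up_blocks ps @ up_blocks qs"
  by (simp_all add: up_blocks_def)

text \<open>Passes from the flat grammar shape to the nested one by regrouping the
  \<open>U\<close>'s: the first opens the path, and each later one opens the layer of the preceding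
  block.\<close>

lemma concat_up_blocks:
  "concat (up_blocks ps) @ U # c @ replicate (length ps) D @ w = U # nest ps c @ w"
proof (induction ps arbitrary: w)
  case (Cons p ps)
  \<comment> \<open>The closing \<open>D\<close> of the outermost layer is absorbed into
    \<open>w\<close>.\<close>
  show ?case using Cons[of "D # w"] by (simp add: replicate_app_Cons_same)
qed simp

lemma list_all2_up_blocks:
  "list_all2 (\<in>) ws (concat (replicate n [{[U]}, L])) \<longleftrightarrow>
     (\<exists>ps. length ps = n \<and> set ps \<subseteq> L \<and> ws = up_blocks ps)"
proof (induction n arbitrary: ws)
  case (Suc n)
  have "list_all2 (\<in>) ws (concat (replicate (Suc n) [{[U]}, L])) \<longleftrightarrow>
      (\<exists>p\<in>L. \<exists>ps. length ps = n \<and> set ps \<subseteq> L \<and> ws = up_blocks (p # ps))"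
    by (auto simp: list_all2_Cons2 Suc)
  also have "\<dots> \<longleftrightarrow> (\<exists>ps. length ps = Suc n \<and> set ps \<subseteq> L \<and> ws = up_blocks ps)"
  proof -
    have ex: "(\<exists>ps. length ps = Suc n \<and> Q ps) \<longleftrightarrow> (\<exists>p ps. length ps = n \<and> Q (p # ps))" for Q
      by (metis length_Suc_conv)
    show ?thesis unfolding ex by auto
  qed
  finally show ?case .
qed simp

lemma list_all2_replicate_singleton:
  "list_all2 (\<in>) ws (replicate n {x}) \<longleftrightarrow> ws = replicate n x"
  by (induction n arbitrary: ws) (auto simp: list_all2_Cons2)

lemma list_all2_single: "list_all2 R ws [L] \<longleftrightarrow> (\<exists>w. ws = [w] \<and> R w L)"
  by (auto simp: list_all2_Cons2)

lemma list_all2_append_iff: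
  "list_all2 R ws (xs @ ys) \<longleftrightarrow> (\<exists>us vs. ws = us @ vs \<and> list_all2 R us xs \<and> list_all2 R vs ys)"
  by (auto simp: list_all2_append2 intro: list_all2_appendI dest: list_all2_lengthD)

section \<open>Factorizations of the grammar cases in nested form\<close>

lemma factorizations_Empty_Case:
  "ws \<in> factorizations (case_factors L A Empty_Case) w \<longleftrightarrow> ws = [] \<and> w = []"
  by (auto simp: factorizations_def)

lemma concat_replicate_singleton: "concat (replicate n [x]) = replicate n x"
  by (induction n) simp_all

text \<open>Depth \<open>k\<close> uses \<open>k\<close> of the \<open>D\<close>'s, and one more
  returns to the axis; hence the index \<open>Suc k\<close>.\<close>

lemma factorizations_Short_Case:
  "ws \<in> factorizations (case_factors L A (Short_Case (Suc k))) w \<longleftrightarrow>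
    (\<exists>ps b. length ps = k \<and> set ps \<subseteq> L \<and> b \<in> L \<and>
       ws = up_blocks ps @ [[U]] @ replicate (Suc k) [D] @ [b] \<and> w = U # nest ps [] @ D # b)"
proof -
  have "list_all2 (\<in>) ws (case_factors L A (Short_Case (Suc k))) \<longleftrightarrow>
    (\<exists>ps b. length ps = k \<and> set ps \<subseteq> L \<and> b \<in> L \<and> ws = up_blocks ps @ [[U]] @ replicate (Suc k) [D] @ [b])"
    unfolding case_factors.simps diff_Suc_1 list_all2_append_iff list_all2_up_blocks
      list_all2_replicate_singleton list_all2_single by blast
  moreover have "concat (up_blocks ps @ [[U]] @ replicate (Suc k) [D] @ [b]) = U # nest ps [] @ D # b"
    if "length ps = k" for ps b
    using concat_up_blocks[of ps "[]" "D # b"] that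
    by (simp add: concat_replicate_singleton replicate_app_Cons_same)
  ultimately show ?thesis unfolding factorizations_def by auto
qed

text \<open>The path of the last block is not followed by a further \<open>U\<close>; it becomes the
  innermost path \<open>c\<close>, so \<open>Suc k\<close> blocks give depth
  \<open>k\<close>.\<close>

lemma factorizations_Long_Case:
  "ws \<in> factorizations (case_factors L (Suc k) Long_Case) w \<longleftrightarrow>
    (\<exists>ps c b. length ps = k \<and> set ps \<subseteq> L \<and> c \<in> L \<and> b \<in> L \<and>
       ws = up_blocks (ps @ [c]) @ replicate (Suc k) [D] @ [b] \<and> w = U # nest ps c @ D # b)"
proof -
  have snoc: "(\<exists>ps. length ps = Suc k \<and> set ps \<subseteq> L \<and> us = up_blocks ps) \<longleftrightarrow>
    (\<exists>ps c. length ps = k \<and> set ps \<subseteq> L \<and> c \<in> L \<and> us = up_blocks (ps @ [c]))" for us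
    unfolding length_Suc_conv_rev by fastforce
  have "list_all2 (\<in>) ws (case_factors L (Suc k) Long_Case) \<longleftrightarrow>
    (\<exists>ps c b. length ps = k \<and> set ps \<subseteq> L \<and> c \<in> L \<and> b \<in> L \<and>
       ws = up_blocks (ps @ [c]) @ replicate (Suc k) [D] @ [b])"
    unfolding case_factors.simps list_all2_append_iff list_all2_up_blocks snoc
      list_all2_replicate_singleton list_all2_single by blast
  moreover have "concat (up_blocks (ps @ [c]) @ replicate (Suc k) [D] @ [b]) = U # nest ps c @ D # b"
    if "length ps = k" for ps c b
    using concat_up_blocks[of ps c "D # b"] that
    by (simp add: concat_replicate_singleton replicate_app_Cons_same)
  ultimately show ?thesis unfolding factorizations_def by auto
qed

text \<open>Uniqueness of the first return fixes the nested part and \<open>b\<close>; uniqueness of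
  nesting then fixes the depth, which determines the case, and the individual factors.\<close>

lemma grammar_factorization_unique:
  assumes L: "\<And>w. w \<in> L \<Longrightarrow> dyck_path w" and "1 \<le> A"
    and "i \<in> grammar_cases A B" "j \<in> grammar_cases A B"
    and "ws \<in> factorizations (case_factors L A i) w" "vs \<in> factorizations (case_factors L A j) w"
  shows "i = j \<and> ws = vs"
proof -
  obtain n where A: "A = Suc n" using \<open>1 \<le> A\<close> by (cases A) auto
  \<comment> \<open>With \<open>A = Suc n\<close>, short cases are nestings of depth below
    \<open>n\<close> around the empty path, and the long case has depth exactly
    \<open>n\<close>.\<close>
  have parse: "(x = Empty_Case \<and> us = [] \<and> w = []) \<or>
      (\<exists>ps b. x = Short_Case (Suc (length ps)) \<and> length ps < n \<and> set ps \<subseteq> L \<and> b \<in> L \<and>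
         us = up_blocks ps @ [[U]] @ replicate (Suc (length ps)) [D] @ [b] \<and> w = U # nest ps [] @ D # b) \<or>
      (\<exists>ps c b. x = Long_Case \<and> length ps = n \<and> set ps \<subseteq> L \<and> c \<in> L \<and> b \<in> L \<and>
         us = up_blocks (ps @ [c]) @ replicate (Suc n) [D] @ [b] \<and> w = U # nest ps c @ D # b)"
    (is "?empty x us \<or> ?short x us \<or> ?long x us")
    if "x \<in> grammar_cases A B" "us \<in> factorizations (case_factors L A x) w" for x us
  proof (cases x)
    case Empty_Case
    then show ?thesis using that factorizations_Empty_Case by simp
  next
    case (Short_Case k)
    then have "1 \<le> k" "k < A" using that(1) by (auto simp: grammar_cases_def)
    then obtain k' where "k = Suc k'" "k' < n" using A by (cases k) auto
    then show ?thesis using that(2) Short_Case unfolding A by (auto simp: factorizations_Short_Case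
          simp del: case_factors.simps)
  next
    case Long_Case
    then show ?thesis using that(2) unfolding A by (auto simp: factorizations_Long_Case
          simp del: case_factors.simps)
  qed
  have dyck: "\<forall>p\<in>set ps. dyck_path p" if "set ps \<subseteq> L" for ps
    using that L by blast
  have outer: "nest ps c = nest qs d \<and> b = b'"
    if "U # nest ps c @ D # b = U # nest qs d @ D # b'" "set ps \<subseteq> L" "set qs \<subseteq> L"
      "dyck_path c" "dyck_path d" for ps qs c d b b'
    using that dyck dyck_path_nest by (intro first_return_unique) auto
  have inner: "nest ps [] \<noteq> nest qs d"
    if "length ps < length qs" "set ps \<subseteq> L" "set qs \<subseteq> L" "dyck_path d" for ps qs d
    using nest_Nil_unique[of ps qs d] that dyck by fastforce
  \<comment> \<open>The short nesting is shallower and ends in the empty path, so it cannot equal a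
    nesting of depth \<open>n\<close>.\<close>
  have short_long: False if "?short x us" "?long y xs" for x y us xs
    using that outer inner L by (metis dyck_path_Nil)
  have "?empty i ws \<or> ?short i ws \<or> ?long i ws" "?empty j vs \<or> ?short j vs \<or> ?long j vs"
    using parse assms by blast+
  then consider "?empty i ws" "?empty j vs" | "?short i ws" "?short j vs" | "?long i ws" "?long j vs"
    using short_long by blast
  then show ?thesis
  proof cases
    case 1
    then show ?thesis by simp
  next
    case 2
    then obtain ps b qs b' where ps: "i = Short_Case (Suc (length ps))" "set ps \<subseteq> L"
      "ws = up_blocks ps @ [[U]] @ replicate (Suc (length ps)) [D] @ [b]" "w = U # nest ps [] @ D # b"
      and qs: "j = Short_Case (Suc (length qs))" "set qs \<subseteq> L"
      "vs = up_blocks qs @ [[U]] @ replicate (Suc (length qs)) [D] @ [b']" "w = U # nest qs [] @ D # b'"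
      by blast
    have eq: "nest ps [] = nest qs []" "b = b'"
      using outer[of ps "[]" b qs "[]" b'] ps qs by auto
    then have "length ps = length qs"
      using inner[of ps qs "[]"] inner[of qs ps "[]"] ps qs by (metis dyck_path_Nil nat_neq_iff)
    then have "ps = qs" using nest_unique[of ps "[]" qs "[]"] eq ps qs dyck by simp
    then show ?thesis using ps qs eq by simp
  next
    case 3
    then obtain ps c b qs d b' where ps: "i = Long_Case" "length ps = n" "set ps \<subseteq> L" "c \<in> L"
      "ws = up_blocks (ps @ [c]) @ replicate (Suc n) [D] @ [b]" "w = U # nest ps c @ D # b"
      and qs: "j = Long_Case" "length qs = n" "set qs \<subseteq> L" "d \<in> L"
      "vs = up_blocks (qs @ [d]) @ replicate (Suc n) [D] @ [b']" "w = U # nest qs d @ D # b'"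
      by blast
    have "nest ps c = nest qs d" "b = b'"
      using outer[of ps c b qs d b'] ps qs L by auto
    then show ?thesis using nest_unique[of ps c qs d] ps qs dyck L by simp
  qed
qed

lemma avoiding_iff_factorization:
  assumes "1 \<le> B" "B < A" and S: "S = {A * r + B | r. r \<ge> 0}"
  defines "L \<equiv> dyck_down_run_avoiding S"
  shows "w \<in> L \<longleftrightarrow> (\<exists>i\<in>grammar_cases A B. \<exists>ws. ws \<in> factorizations (case_factors L A i) w)"
proof -
  obtain n where A: "A = Suc n" using assms(1,2) by (cases A) auto
  have mod: "m \<in> S \<longleftrightarrow> m mod A = B \<and> B \<le> m" for m
    unfolding S using assms(1,2) by (auto simp: mod_less) (metis mult_div_mod_eq)
  have small: "k \<in> S \<longleftrightarrow> k = B" if "k < A" for k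
    using that by (auto simp: mod)
  have "m + A \<in> S \<longleftrightarrow> m \<in> S" if "m \<ge> 1" for m
    using assms(1,2) mod_less_eq_dividend[of m A] by (auto simp: mod)
  moreover have "A \<notin> S" using assms(1,2) by (auto simp: mod)
  ultimately have period: "avoiding_before S A = L"
    using avoids_append_period assms(1,2)
    unfolding L_def avoiding_before_0[symmetric] avoiding_before_def by simp
  \<comment> \<open>From index 1, unfolding \<open>n = A - 1\<close> layers reaches index
    \<open>A\<close>. Stopping early leaves a run shorter than \<open>A\<close>, which is forbidden
    only if its length is \<open>B\<close>.\<close>
  have "a \<in> avoiding_before S 1 \<longleftrightarrow>
    (\<exists>ps. length ps < n \<and> set ps \<subseteq> L \<and> Suc (length ps) \<noteq> B \<and> a = nest ps []) \<or>
    (\<exists>ps c. length ps = n \<and> set ps \<subseteq> L \<and> c \<in> L \<and> a = nest ps c)" for a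
    using avoiding_before_nest[of 1 a S n] period A small
    unfolding L_def[symmetric] by (auto simp: L_def[symmetric])
  then have "w \<in> L \<longleftrightarrow> w = [] \<or>
    (\<exists>ps. \<exists>b\<in>L. length ps < n \<and> set ps \<subseteq> L \<and> Suc (length ps) \<noteq> B \<and> w = U # nest ps [] @ D # b) \<or>
    (\<exists>ps c. \<exists>b\<in>L. length ps = n \<and> set ps \<subseteq> L \<and> c \<in> L \<and> w = U # nest ps c @ D # b)"
    unfolding L_def by (subst avoiding_first_return) blast
  also have "(\<exists>ps. \<exists>b\<in>L. length ps < n \<and> set ps \<subseteq> L \<and> Suc (length ps) \<noteq> B \<and> w = U # nest ps [] @ D # b)
    \<longleftrightarrow> (\<exists>k<n. Suc k \<noteq> B \<and> (\<exists>ws. ws \<in> factorizations (case_factors L A (Short_Case (Suc k))) w))"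
    unfolding factorizations_Short_Case by blast
  also have "(\<exists>ps c. \<exists>b\<in>L. length ps = n \<and> set ps \<subseteq> L \<and> c \<in> L \<and> w = U # nest ps c @ D # b)
    \<longleftrightarrow> (\<exists>ws. ws \<in> factorizations (case_factors L A Long_Case) w)"
    unfolding A factorizations_Long_Case by blast
  also have "w = [] \<longleftrightarrow> (\<exists>ws. ws \<in> factorizations (case_factors L A Empty_Case) w)"
    unfolding factorizations_Empty_Case by blast
  also have "(\<exists>k<n. Suc k \<noteq> B \<and> (\<exists>ws. ws \<in> factorizations (case_factors L A (Short_Case (Suc k))) w))
    \<longleftrightarrow> (\<exists>k\<in>{k. 1 \<le> k \<and> k < A \<and> k \<noteq> B}. \<exists>ws. ws \<in> factorizations (case_factors L A (Short_Case k)) w)"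
    unfolding A by (auto simp: Bex_def simp del: case_factors.simps) (metis Suc_le_D Suc_less_eq)
  finally show ?thesis unfolding grammar_cases_def by blast
qed

text \<open>Determining index and factor list jointly covers both kinds of ambiguity.\<close>

lemma unambiguous_grammarI:
  assumes "\<And>w. w \<in> L \<longleftrightarrow> (\<exists>i\<in>I. \<exists>ws. ws \<in> factorizations (F i) w)"
    and "\<And>i j w ws vs. i \<in> I \<Longrightarrow> j \<in> I \<Longrightarrow> ws \<in> factorizations (F i) w \<Longrightarrow>
      vs \<in> factorizations (F j) w \<Longrightarrow> i = j \<and> ws = vs"
  shows "unambiguous_grammar L I F"
proof -
  have c: "w \<in> conc_list (F i) \<longleftrightarrow> (\<exists>ws. ws \<in> factorizations (F i) w)" for w i
    unfolding conc_list_def by blast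
  show ?thesis
    unfolding unambiguous_grammar_def
  proof (intro conjI ballI impI)
    show "L = (\<Union>i\<in>I. conc_list (F i))" using assms(1) c by blast
  next
    fix w assume "w \<in> L"
    then show "\<exists>!i. i \<in> I \<and> w \<in> conc_list (F i)" using assms c by meson
  next
    fix w i assume "i \<in> I" "w \<in> conc_list (F i)"
    then show "\<exists>!ws. ws \<in> factorizations (F i) w" using assms(2) c by meson
  qed
qed


section \<open>Enumeration by the number of up-steps\<close>

text \<open>Counting \<open>U\<close>'s is additive under concatenation and makes sense for single
  letters, whose length is odd; on Dyck paths it gives the semilength.\<close>

definition up_enumerator :: "step list set \<Rightarrow> int fps" where
  "up_enumerator L = Abs_fps (\<lambda>n. int (card {w \<in> L. count_list w U = n}))"

lemma up_enumerator_nth: "fps_nth (up_enumerator L) n = int (card {w \<in> L. count_list w U = n})"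
  by (simp add: up_enumerator_def)

lemma up_enumerator_dyck:
  assumes "\<And>w. w \<in> L \<Longrightarrow> dyck_path w"
  shows "up_enumerator L = weight_enumerator L"
proof -
  have "{w \<in> L. count_list w U = n} = {w \<in> L. length w = 2 * n}" for n
    using assms dyck_path_length by fastforce
  then show ?thesis by (simp add: up_enumerator_def weight_enumerator_def)
qed

lemma finite_dyck_up_count:
  assumes "\<And>w. w \<in> L \<Longrightarrow> dyck_path w"
  shows "finite {w \<in> L. count_list w U = n}"
proof (rule finite_subset)
  have UD: "s \<in> {U, D}" for s by (cases s) auto
  show "{w \<in> L. count_list w U = n} \<subseteq> {w. set w \<subseteq> {U, D} \<and> length w = 2 * n}"
    using assms dyck_path_length UD by fastforce
  show "finite {w. set w \<subseteq> {U, D} \<and> length w = 2 * n}"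
    by (rule finite_lists_length_eq) simp
qed

lemma up_enumerator_singleton: "up_enumerator {w} = fps_X ^ count_list w U"
proof (rule fps_ext)
  fix n
  have "{v \<in> {w}. count_list v U = n} = (if n = count_list w U then {w} else {})" by auto
  then show "fps_nth (up_enumerator {w}) n = fps_nth (fps_X ^ count_list w U) n"
    by (simp add: up_enumerator_nth fps_X_power_nth)
qed

text \<open>The Cauchy product: pairs are grouped by the number of \<open>U\<close>'s in the first
  component, and injectivity makes counting pairs the same as counting words. Finiteness matters
  because \<open>card\<close> is 0 on infinite sets; it is also concluded, so that the lemma can be
  iterated.\<close>

lemma up_enumerator_conc:
  assumes inj: "inj_on (\<lambda>(u, v). u @ v) (L \<times> M)"
    and finL: "\<And>n. finite {w \<in> L. count_list w U = n}"
    and finM: "\<And>n. finite {w \<in> M. count_list w U = n}"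
  shows "finite {w \<in> L @@ M. count_list w U = n}"
    and "up_enumerator (L @@ M) = up_enumerator L * up_enumerator M"
proof -
  let ?L = "\<lambda>n. {w \<in> L. count_list w U = n}" and ?M = "\<lambda>n. {w \<in> M. count_list w U = n}"
  let ?X = "\<lambda>n. \<Union>i\<in>{0..n}. ?L i \<times> ?M (n - i)"
  have img: "{w \<in> L @@ M. count_list w U = n} = (\<lambda>(u, v). u @ v) ` ?X n" for n
  proof (intro equalityI subsetI)
    fix w assume "w \<in> {w \<in> L @@ M. count_list w U = n}"
    then obtain u v where "w = u @ v" "u \<in> L" "v \<in> M" "count_list u U + count_list v U = n"
      by (auto simp: conc_def)
    then show "w \<in> (\<lambda>(u, v). u @ v) ` ?X n"
      by (intro image_eqI[of _ _ "(u, v)"]) auto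
  qed (auto simp: conc_def)
  show "finite {w \<in> L @@ M. count_list w U = n}" for n
    unfolding img using finL finM by (intro finite_imageI finite_UN_I finite_cartesian_product) auto
  show "up_enumerator (L @@ M) = up_enumerator L * up_enumerator M"
  proof (rule fps_ext)
    fix n
    have "card {w \<in> L @@ M. count_list w U = n} = card (?X n)"
      unfolding img by (rule card_image) (rule inj_on_subset[OF inj], auto)
    also have "\<dots> = (\<Sum>i=0..n. card (?L i \<times> ?M (n - i)))"
      using finL finM by (intro card_UN_disjoint) auto
    finally show "fps_nth (up_enumerator (L @@ M)) n = fps_nth (up_enumerator L * up_enumerator M) n"
      by (simp add: up_enumerator_nth fps_mult_nth card_cartesian_product)
  qed
qed

lemma conc_list_iff: "w \<in> conc_list Ls \<longleftrightarrow> (\<exists>ws. list_all2 (\<in>) ws Ls \<and> w = concat ws)"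
  by (auto simp: conc_list_def factorizations_def)

lemma up_enumerator_conc_list:
  assumes "inj_on concat {ws. list_all2 (\<in>) ws Ls}"
    and "\<And>L n. L \<in> set Ls \<Longrightarrow> finite {w \<in> L. count_list w U = n}"
  shows "up_enumerator (conc_list Ls) = prod_list (map up_enumerator Ls)"
proof -
  have "(\<forall>n. finite {w \<in> conc_list Ls. count_list w U = n}) \<and>
    up_enumerator (conc_list Ls) = prod_list (map up_enumerator Ls)"
    using assms
  proof (induction Ls)
    case Nil
    then show ?case by (simp add: conc_list_Nil up_enumerator_singleton)
  next
    case (Cons L Ls)
    show ?case
    \<comment> \<open>Injectivity for the tail is derived by prefixing a fixed word of
      \<open>L\<close>. If there is none, both sides are 0.\<close>
    proof (cases "L = {}")
      case True
      then have "conc_list (L # Ls) = {}" by (simp add: conc_list_Cons conc_def)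
      moreover have "up_enumerator {} = 0" by (rule fps_ext) (simp add: up_enumerator_nth)
      ultimately show ?thesis using True by simp
    next
      case False
      then obtain u where u: "u \<in> L" by blast
      have "inj_on concat {ws. list_all2 (\<in>) ws Ls}"
      proof (rule inj_onI)
        fix ws vs assume "ws \<in> {ws. list_all2 (\<in>) ws Ls}" "vs \<in> {ws. list_all2 (\<in>) ws Ls}"
          "concat ws = concat vs"
        then show "ws = vs"
          using inj_onD[OF Cons.prems(1), of "u # ws" "u # vs"] u by simp
      qed
      then have IH: "\<forall>n. finite {w \<in> conc_list Ls. count_list w U = n}"
        "up_enumerator (conc_list Ls) = prod_list (map up_enumerator Ls)"
        using Cons by auto
      have "inj_on (\<lambda>(u, v). u @ v) (L \<times> conc_list Ls)"
      proof (rule inj_onI, clarify)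
        fix u v u' v'
        assume "u \<in> L" "u' \<in> L" "v \<in> conc_list Ls" "v' \<in> conc_list Ls" "u @ v = u' @ v'"
        moreover from this obtain ws ws' where "list_all2 (\<in>) ws Ls" "v = concat ws"
          "list_all2 (\<in>) ws' Ls" "v' = concat ws'" unfolding conc_list_iff by blast
        ultimately show "u = u' \<and> v = v'"
          using inj_onD[OF Cons.prems(1), of "u # ws" "u' # ws'"] by simp
      qed
      then show ?thesis
        using up_enumerator_conc[of L "conc_list Ls"] IH Cons.prems(2)
        by (simp add: conc_list_Cons)
    qed
  qed
  then show ?thesis by blast
qed

lemma up_enumerator_UN:
  assumes "finite I" "\<And>i n. i \<in> I \<Longrightarrow> finite {w \<in> M i. count_list w U = n}"
    and "\<And>i j. i \<in> I \<Longrightarrow> j \<in> I \<Longrightarrow> i \<noteq> j \<Longrightarrow> M i \<inter> M j = {}"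
  shows "up_enumerator (\<Union>i\<in>I. M i) = (\<Sum>i\<in>I. up_enumerator (M i))"
proof (rule fps_ext)
  fix n
  have "{w \<in> (\<Union>i\<in>I. M i). count_list w U = n} = (\<Union>i\<in>I. {w \<in> M i. count_list w U = n})" by auto
  moreover have "card \<dots> = (\<Sum>i\<in>I. card {w \<in> M i. count_list w U = n})"
    using assms by (intro card_UN_disjoint) blast+
  ultimately show "fps_nth (up_enumerator (\<Union>i\<in>I. M i)) n = fps_nth (\<Sum>i\<in>I. up_enumerator (M i)) n"
    by (simp add: up_enumerator_nth fps_sum_nth)
qed

text \<open>Uniqueness of the case makes the union disjoint and gives the sum; uniqueness of the
  factorization gives the products.\<close>

lemma up_enumerator_unambiguous_grammar:
  assumes un: "unambiguous_grammar L I F" and "finite I"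
    and finL: "\<And>n. finite {w \<in> L. count_list w U = n}"
    and finF: "\<And>i M n. i \<in> I \<Longrightarrow> M \<in> set (F i) \<Longrightarrow> finite {w \<in> M. count_list w U = n}"
  shows "up_enumerator L = (\<Sum>i\<in>I. prod_list (map up_enumerator (F i)))"
proof -
  have L: "L = (\<Union>i\<in>I. conc_list (F i))"
    and case_unique: "\<And>w. w \<in> L \<Longrightarrow> \<exists>!i. i \<in> I \<and> w \<in> conc_list (F i)"
    and factorization_unique:
      "\<And>w i. w \<in> L \<Longrightarrow> i \<in> I \<Longrightarrow> w \<in> conc_list (F i) \<Longrightarrow> \<exists>!ws. ws \<in> factorizations (F i) w"
    using un unfolding unambiguous_grammar_def by blast+
  have fin: "finite {w \<in> conc_list (F i). count_list w U = n}" if "i \<in> I" for i n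
    by (rule finite_subset[OF _ finL[of n]]) (use L that in blast)
  have inj: "inj_on concat {ws. list_all2 (\<in>) ws (F i)}" if i: "i \<in> I" for i
  proof (rule inj_onI)
    fix ws vs
    assume *: "ws \<in> {ws. list_all2 (\<in>) ws (F i)}" "vs \<in> {ws. list_all2 (\<in>) ws (F i)}"
      "concat ws = concat vs"
    then have "ws \<in> factorizations (F i) (concat ws)" "vs \<in> factorizations (F i) (concat ws)"
      by (auto simp: factorizations_def)
    moreover have "concat ws \<in> conc_list (F i)" using * conc_list_iff by blast
    then have "\<exists>!us. us \<in> factorizations (F i) (concat ws)"
      using factorization_unique[OF _ i] L i by blast
    ultimately show "ws = vs" by blast
  qed
  have "up_enumerator L = (\<Sum>i\<in>I. up_enumerator (conc_list (F i)))"
    unfolding L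
  proof (rule up_enumerator_UN)
    fix i j assume "i \<in> I" "j \<in> I" "i \<noteq> j"
    then show "conc_list (F i) \<inter> conc_list (F j) = {}" using case_unique L by blast
  qed (use fin \<open>finite I\<close> in auto)
  also have "\<dots> = (\<Sum>i\<in>I. prod_list (map up_enumerator (F i)))"
    using inj finF by (intro sum.cong up_enumerator_conc_list) auto
  finally show ?thesis .
qed

section \<open>Weights of the grammar cases\<close>

lemma set_case_factors: "set (case_factors L A i) \<subseteq> {{[U]}, {[D]}, L}"
  by (cases i) (auto split: if_splits)

lemma sum_grammar_cases:
  fixes f :: "grammar_case \<Rightarrow> 'a :: comm_monoid_add"
  shows "sum f (grammar_cases A B) =
    f Empty_Case + (\<Sum>k | 1 \<le> k \<and> k < A \<and> k \<noteq> B. f (Short_Case k)) + f Long_Case"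
proof -
  let ?K = "{k. 1 \<le> k \<and> k < A \<and> k \<noteq> B}"
  have fin: "finite ?K" by simp
  have "sum f (grammar_cases A B) = sum f (insert Empty_Case (insert Long_Case (Short_Case ` ?K)))"
    unfolding grammar_cases_def by (rule arg_cong[of _ _ "sum f"]) blast
  also have "\<dots> = f Empty_Case + (f Long_Case + sum f (Short_Case ` ?K))"
    using fin by (subst sum.insert; auto)+
  also have "sum f (Short_Case ` ?K) = (\<Sum>k\<in>?K. f (Short_Case k))"
    by (subst sum.reindex) (auto simp: inj_on_def)
  finally show ?thesis by (simp add: ac_simps)
qed

lemma prod_list_concat_replicate:
  fixes f :: "'b \<Rightarrow> 'a :: monoid_mult"
  shows "prod_list (map f (concat (replicate n xs))) = prod_list (map f xs) ^ n"
  by (induction n) simp_all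

theorem proposition9:
  fixes A B :: nat and \<P> :: "step list set" and P :: "int fps"
  assumes "1 \<le> B" and "B < A"
    and "\<P> = dyck_down_run_avoiding {A * r + B | r. r \<ge> 0}"
    and "P = weight_enumerator \<P>"
  shows "\<P> = {[]}
           \<union> (\<Union>k\<in>{k. 1 \<le> k \<and> k < A \<and> k \<noteq> B}.
                (({[U]} @@ \<P>) ^^^ (k - 1)) @@ {[U]} @@ ({[D]} ^^^ k) @@ \<P>)
           \<union> (({[U]} @@ \<P>) ^^^ A) @@ ({[D]} ^^^ A) @@ \<P>
    \<and> unambiguous_grammar \<P> (grammar_cases A B) (case_factors \<P> A)
    \<and> P = 1 + (\<Sum>k | 1 \<le> k \<and> k < A \<and> k \<noteq> B. fps_X ^ k * P ^ k) + fps_X ^ A * P ^ (A + 1)"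
proof -
  let ?F = "case_factors \<P> A" and ?I = "grammar_cases A B"
  have dyck: "\<And>w. w \<in> \<P> \<Longrightarrow> dyck_path w"
    unfolding assms(3) dyck_down_run_avoiding_def by blast
  have un: "unambiguous_grammar \<P> ?I ?F"
  proof (rule unambiguous_grammarI)
    show "w \<in> \<P> \<longleftrightarrow> (\<exists>i\<in>?I. \<exists>ws. ws \<in> factorizations (?F i) w)" for w
      unfolding assms(3) by (rule avoiding_iff_factorization[OF assms(1,2) refl])
  next
    fix i j w ws vs
    assume "i \<in> ?I" "j \<in> ?I" "ws \<in> factorizations (?F i) w" "vs \<in> factorizations (?F j) w"
    then show "i = j \<and> ws = vs"
      using grammar_factorization_unique[of \<P> A] dyck assms(1,2) by simp
  qed
  have language: "\<P> = {[]}
           \<union> (\<Union>k\<in>{k. 1 \<le> k \<and> k < A \<and> k \<noteq> B}.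
                (({[U]} @@ \<P>) ^^^ (k - 1)) @@ {[U]} @@ ({[D]} ^^^ k) @@ \<P>)
           \<union> (({[U]} @@ \<P>) ^^^ A) @@ ({[D]} ^^^ A) @@ \<P>"
  proof -
    have "\<P> = (\<Union>i\<in>?I. conc_list (?F i))"
      using un unfolding unambiguous_grammar_def by blast
    also have "\<dots> = conc_list (?F Empty_Case)
        \<union> (\<Union>k\<in>{k. 1 \<le> k \<and> k < A \<and> k \<noteq> B}. conc_list (?F (Short_Case k)))
        \<union> conc_list (?F Long_Case)"
      unfolding grammar_cases_def by blast
    finally show ?thesis unfolding conc_list_case_factors .
  qed
  have P: "up_enumerator \<P> = P"
    using up_enumerator_dyck dyck assms(4) by simp
  have enum: "up_enumerator \<P> = (\<Sum>i\<in>?I. prod_list (map up_enumerator (?F i)))"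
  proof (rule up_enumerator_unambiguous_grammar[OF un])
    show "finite ?I" by (simp add: grammar_cases_def)
    show fin: "finite {w \<in> \<P>. count_list w U = n}" for n
      by (rule finite_dyck_up_count) (rule dyck)
    show "finite {w \<in> M. count_list w U = n}" if "M \<in> set (?F i)" for i M n
    proof -
      have "M \<in> {{[U]}, {[D]}, \<P>}" using that set_case_factors by blast
      then show ?thesis using fin by auto
    qed
  qed
  have weights: "up_enumerator {[U]} = fps_X" "up_enumerator {[D]} = 1"
    by (simp_all add: up_enumerator_singleton)
  \<comment> \<open>The \<open>k - 1\<close> blocks and the extra \<open>U\<close> give k factors z,
    each \<open>D\<close> has weight 1, and the final path supplies the k-th factor
    \<open>P\<close>.\<close>
  have short: "prod_list (map up_enumerator (?F (Short_Case k))) = fps_X ^ k * P ^ k"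
    if "1 \<le> k" for k
    using that by (cases k)
      (simp_all add: prod_list_concat_replicate weights P power_mult_distrib prod_list_replicate mult_ac)
  \<comment> \<open>Here all \<open>A\<close> blocks carry a path, and the final one makes the
    exponent \<open>A + 1\<close>.\<close>
  have long: "prod_list (map up_enumerator (?F Long_Case)) = fps_X ^ A * P ^ (A + 1)"
    by (simp add: prod_list_concat_replicate weights P power_mult_distrib prod_list_replicate mult_ac)
  have "P = 1 + (\<Sum>k | 1 \<le> k \<and> k < A \<and> k \<noteq> B. fps_X ^ k * P ^ k) + fps_X ^ A * P ^ (A + 1)"
  proof -
    have "(\<Sum>k | 1 \<le> k \<and> k < A \<and> k \<noteq> B. prod_list (map up_enumerator (?F (Short_Case k)))) =
        (\<Sum>k | 1 \<le> k \<and> k < A \<and> k \<noteq> B. fps_X ^ k * P ^ k)"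
      by (intro sum.cong refl short) simp
    then show ?thesis using enum unfolding P sum_grammar_cases long by simp
  qed
  then show ?thesis using language un by blast
qed

end
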